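(* Let $p$ be a prime, let $G$ be a $p$-group, and let $x \in G$ be a non-identity element of order $p$. Then $x$ is adjacent to every other vertex of the component of the proper power graph $\mathcal{G}^*(G)$ that contains $x$.
   Context: A $p$-group is a finite group whose order is a power of $p$. The power graph $\mathcal{G}(G)$ of a group $G$ is the simple undirected graph with vertex set $G$ in which two distinct vertices $u,v$ are adjacent if $v=u^\alpha$ or $u=v^\alpha$ for some positive integer $\alpha$. The proper power graph $\mathcal{G}^*(G)$ is obtained from $\mathcal{G}(G)$ by deleting the identity element. A component of a graph is a maximal connected subgraph. *)

theory Defs
  imports
    "HOL-Computational_Algebra.Primes"
    "HOL-Algebra.Multiplicative_Group"
    "Graph_Theory.Digraph_Component"
begin

definition p_group :: "nat \<Rightarrow> ('a, 'b) monoid_scheme \<Rightarrow> bool" where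
  "p_group p G \<longleftrightarrow> group G \<and> finite (carrier G) \<and> (\<exists>n::nat. Coset.order G = p ^ n)"

text \<open>A simple undirected graph is represented as a symmetric loop-free digraph: each edge
  \<open>{u, v}\<close> is the pair of arcs \<open>(u, v)\<close> and \<open>(v, u)\<close>.\<close>

definition power_graph :: "('a, 'b) monoid_scheme \<Rightarrow> 'a pair_pre_digraph" where
  "power_graph G = \<lparr> pverts = carrier G,
     parcs = {(u, v). u \<in> carrier G \<and> v \<in> carrier G \<and> u \<noteq> v \<and>
       (\<exists>\<alpha>::nat. \<alpha> > 0 \<and> (v = u [^]\<^bsub>G\<^esub> \<alpha> \<or> u = v [^]\<^bsub>G\<^esub> \<alpha>))} \<rparr>"

definition proper_power_graph :: "('a, 'b) monoid_scheme \<Rightarrow> ('a, 'a \<times> 'a) pre_digraph" where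
  "proper_power_graph G = pre_digraph.del_vert (with_proj (power_graph G)) \<one>\<^bsub>G\<^esub>"

text \<open>The subgraphs \<open>max_subgraph\<close> ranges over need not be symmetric, and \<open>connected\<close> ignores
  the direction of arcs; a maximal one contains both arcs of each of its edges as soon as
  \<open>\<Gamma>\<close> does.\<close>

definition is_component :: "('a, 'b) pre_digraph \<Rightarrow> ('a, 'b) pre_digraph \<Rightarrow> bool" where
  "is_component \<Gamma> C \<longleftrightarrow> pre_digraph.max_subgraph \<Gamma> Digraph_Component.connected C"

lemma pair_bidirected_power_graph: "pair_bidirected_digraph (power_graph G)"
  by unfold_locales (auto simp: power_graph_def symmetric_def sym_def)

lemma sym_digraph_proper_power_graph: "sym_digraph (proper_power_graph G)"
proof -
  interpret P: pair_bidirected_digraph "power_graph G"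
    by (rule pair_bidirected_power_graph)
  have "symmetric (proper_power_graph G)"
    by (auto simp: proper_power_graph_def symmetric_conv pre_digraph.del_vert_def power_graph_def)
  then show ?thesis
    unfolding proper_power_graph_def
    by (intro wf_digraph.sym_digraphI P.wf_digraph_del_vert)
qed

lemma ex_component:
  assumes "x \<in> carrier G" "x \<noteq> \<one>\<^bsub>G\<^esub>"
  shows "\<exists>C. is_component (proper_power_graph G) C \<and> x \<in> verts C"
proof -
  interpret sym_digraph "proper_power_graph G"
    by (rule sym_digraph_proper_power_graph)
  let ?\<Gamma> = "proper_power_graph G"
  let ?C = "?\<Gamma> \<restriction> {v. x \<rightarrow>\<^sup>*\<^bsub>?\<Gamma>\<^esub> v}"
  have x: "x \<in> verts ?\<Gamma>"
    using assms by (simp add: proper_power_graph_def power_graph_def pre_digraph.del_vert_def)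
  then have "?C \<in> sccs"
    by (rule induce_reachable_is_in_sccs)
  then have C: "induced_subgraph ?C ?\<Gamma>" "strongly_connected ?C"
    by auto
  have "max_subgraph Digraph_Component.connected ?C"
  proof (rule max_subgraphI)
    show "Digraph_Component.connected ?C"
      using C(2) wf_digraph.reachable_mk_symmetricI[OF wf_digraphI_induced[OF C(1)]]
      by (auto simp: Digraph_Component.connected_def strongly_connected_def)
    show "subgraph ?C ?\<Gamma>"
      using C(1) by blast
    fix D assume D: "?C \<noteq> D" "subgraph ?C D" "subgraph D ?\<Gamma>"
    show "\<not> Digraph_Component.connected D"
    proof
      assume con: "Digraph_Component.connected D"
      have "x \<in> verts ?C"
        using x by simp
      then have xD: "x \<in> verts D"
        using D(2) by (meson subgraph_imp_subverts subsetD)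
      have "x \<rightarrow>\<^sup>*\<^bsub>?\<Gamma>\<^esub> v" if "v \<in> verts D" for v
      proof -
        have "x \<rightarrow>\<^sup>*\<^bsub>mk_symmetric D\<^esub> v"
          using con xD that by (auto simp: Digraph_Component.connected_def)
        then have "x \<rightarrow>\<^sup>*\<^bsub>mk_symmetric ?\<Gamma>\<^esub> v"
          by (rule pre_digraph.reachable_mono) (rule subgraph_mk_symmetric[OF D(3)])
        then show ?thesis
          using reachable_mk_symmetric_eq[OF sym_arcs] by simp
      qed
      then have "verts D \<subseteq> verts ?C"
        by auto
      then have "verts D = verts ?C" "arcs D = arcs ?C"
        using D(2,3)
        by (auto simp: subgraph_def compatible_def wf_digraph_def simp del: induce_subgraph_verts)
          (auto simp: induce_subgraph_def)
      then have "D = ?C"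
        using D(2) by (simp add: subgraph_def compatible_def)
      with D(1) show False by simp
    qed
  qed
  with x show ?thesis
    unfolding is_component_def by (intro exI[of _ ?C]) auto
qed

end

theory Submission
  imports Defs "HOL-Number_Theory.Cong"
begin

text \<open>
  The vertices of which \<open>x\<close> is a power form a set that contains \<open>x\<close>, and every member other than
  \<open>x\<close> is adjacent to \<open>x\<close>. So it suffices that this set is closed under adjacency
  (\<open>power_of_adjacent\<close>): a path starting at \<open>x\<close> can then never leave it. Suppose that \<open>x\<close> is
  a power of \<open>v\<close> and that \<open>w\<close> is adjacent to \<open>v\<close>. If \<open>v\<close> is a power of \<open>w\<close>, so is \<open>x\<close>. If
  \<open>w\<close> is a power of \<open>v\<close>, both \<open>x\<close> and \<open>w\<close> lie in the cyclic \<open>p\<close>-group generated by \<open>v\<close>.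
  The subgroups of that group form a chain, and the one generated by \<open>x\<close> has order \<open>p\<close>, so it is
  the smallest nontrivial one and is contained in the one generated by \<open>w \<noteq> \<one>\<close>
  (\<open>power_of_nontrivial_power\<close>).
\<close>

text \<open>In exponents, the claim is that \<open>a * t \<equiv> b\<close> modulo the order of \<open>v\<close> is solvable for \<open>t\<close>.\<close>

lemma (in group) power_of_power_if_gcd_dvd:
  fixes a b :: nat
  assumes v: "v \<in> carrier G" and dvd: "gcd a (ord v) dvd b"
  shows "\<exists>t::nat. v [^] b = (v [^] a) [^] t"
proof -
  obtain t where "[a * t = b] (mod ord v)"
    using cong_solve_dvd_nat[OF dvd] by blast
  then have "int (ord v) dvd int (a * t) - int b"
    by (metis cong_iff_dvd_diff cong_int_iff)
  then have "v [^] b = v [^] (a * t)"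
    using int_pow_eq[OF v, of "int b" "int (a * t)"] by (simp only: int_pow_int)
  then show ?thesis
    using v by (metis nat_pow_pow)
qed

text \<open>
  With \<open>ord v = p ^ n\<close>, the exponent \<open>b\<close> is divisible by \<open>p ^ (n - 1)\<close> because the order of
  \<open>v [^] b\<close> divides \<open>p\<close>, while \<open>gcd a (p ^ n)\<close> is a proper divisor of \<open>p ^ n\<close> because
  \<open>v [^] a \<noteq> \<one>\<close>. Proper divisors of \<open>p ^ n\<close> divide \<open>p ^ (n - 1)\<close>.
\<close>

lemma (in group) power_of_nontrivial_power:
  fixes a b n p :: nat
  assumes p: "prime p" and v: "v \<in> carrier G" and ord: "ord v = p ^ n"
    and b: "(v [^] b) [^] p = \<one>" and a: "v [^] a \<noteq> \<one>"
  shows "\<exists>t::nat. v [^] b = (v [^] a) [^] t"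
proof -
  obtain j where j: "j \<le> n" "gcd a (p ^ n) = p ^ j"
    using divides_primepow_nat[OF p] gcd_dvd2 by blast
  have "\<not> p ^ n dvd a"
    using a v ord by (simp add: pow_eq_id)
  then have "j \<noteq> n"
    using j(2) by (metis gcd_dvd1)
  with j(1) obtain m where n: "n = Suc m" and "j \<le> m"
    by (cases n) auto
  have "p ^ n dvd b * p"
    using b v ord by (simp add: nat_pow_pow pow_eq_id)
  then have "p ^ m dvd b"
    using p n by (simp add: prime_gt_0_nat mult.commute)
  then have "gcd a (ord v) dvd b"
    using \<open>j \<le> m\<close> j(2) ord by (metis dvd_trans le_imp_power_dvd)
  then show ?thesis
    by (rule power_of_power_if_gcd_dvd[OF v])
qed

lemma adjacent_proper_power_graph_iff:
  "u \<rightarrow>\<^bsub>proper_power_graph G\<^esub> v \<longleftrightarrow>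
    u \<in> carrier G - {\<one>\<^bsub>G\<^esub>} \<and> v \<in> carrier G - {\<one>\<^bsub>G\<^esub>} \<and> u \<noteq> v \<and>
    (\<exists>k::nat. k > 0 \<and> (v = u [^]\<^bsub>G\<^esub> k \<or> u = v [^]\<^bsub>G\<^esub> k))"
  by (auto simp: proper_power_graph_def power_graph_def pre_digraph.del_vert_def
      arcs_ends_def arc_to_ends_def)

lemma power_of_adjacent:
  fixes G (structure)
  assumes p: "prime p" and G: "p_group p G" and xp: "x [^] p = \<one>"
    and adj: "v \<rightarrow>\<^bsub>proper_power_graph G\<^esub> w" and xv: "\<exists>t::nat. x = v [^] t"
  shows "\<exists>t::nat. x = w [^] t"
proof -
  interpret group G
    using G by (simp add: p_group_def)
  have v: "v \<in> carrier G" and w: "w \<in> carrier G" "w \<noteq> \<one>"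
    using adj by (auto simp: adjacent_proper_power_graph_iff)
  obtain b :: nat where b: "x = v [^] b"
    using xv by blast
  consider (up) k :: nat where "v = w [^] k" | (down) k :: nat where "w = v [^] k"
    using adj by (auto simp: adjacent_proper_power_graph_iff)
  then show ?thesis
  proof cases
    case up
    then show ?thesis
      using b w(1) by (metis nat_pow_pow)
  next
    case down
    obtain m where "Coset.order G = p ^ m"
      using G by (auto simp: p_group_def)
    then have "ord v dvd p ^ m"
      using ord_dvd_group_order[OF v] by simp
    then obtain n where "ord v = p ^ n"
      using divides_primepow_nat[OF p] by blast
    then show ?thesis
      using power_of_nontrivial_power[OF p v] b down w(2) xp by metis
  qed
qed

text \<open>
  Paths in \<open>C\<close> may traverse arcs backwards, which is harmless because the surrounding graph is
  symmetric.
\<close>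

lemma reachable_if_in_connected_subgraph:
  assumes sym: "sym_digraph \<Gamma>" and sub: "subgraph C \<Gamma>"
    and con: "Digraph_Component.connected C" and "x \<in> verts C" and "y \<in> verts C"
  shows "x \<rightarrow>\<^sup>*\<^bsub>\<Gamma>\<^esub> y"
proof -
  interpret sym_digraph \<Gamma>
    by (rule sym)
  have "x \<rightarrow>\<^sup>*\<^bsub>mk_symmetric C\<^esub> y"
    using con assms(4,5) by (auto simp: Digraph_Component.connected_def)
  then have "x \<rightarrow>\<^sup>*\<^bsub>mk_symmetric \<Gamma>\<^esub> y"
    by (rule pre_digraph.reachable_mono) (rule subgraph_mk_symmetric[OF sub])
  then show ?thesis
    using reachable_mk_symmetric_eq[OF sym_arcs] by simp
qed

theorem proposition3p1:
  fixes G :: "('a, 'b) monoid_scheme"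
    and p :: nat
    and x :: 'a
    and C :: "('a, 'a \<times> 'a) pre_digraph"
  assumes "prime p"
    and "p_group p G"
    and "x \<in> carrier G" and "x \<noteq> \<one>\<^bsub>G\<^esub>" and "group.ord G x = p"
    and "is_component (proper_power_graph G) C" and "x \<in> verts C"
  shows "\<forall>y \<in> verts C. y \<noteq> x \<longrightarrow> x \<rightarrow>\<^bsub>proper_power_graph G\<^esub> y"
proof (intro ballI impI)
  fix y assume y: "y \<in> verts C" "y \<noteq> x"
  interpret group G
    using assms(2) by (simp add: p_group_def)
  interpret P: sym_digraph "proper_power_graph G"
    by (rule sym_digraph_proper_power_graph)
  have xp: "x [^]\<^bsub>G\<^esub> p = \<one>\<^bsub>G\<^esub>"
    using pow_ord_eq_1[OF assms(3)] assms(5) by simp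
  have "subgraph C (proper_power_graph G)" "Digraph_Component.connected C"
    using assms(6) by (auto simp: is_component_def pre_digraph.max_subgraph_def)
  then have reach: "x \<rightarrow>\<^sup>*\<^bsub>proper_power_graph G\<^esub> y"
    by (rule reachable_if_in_connected_subgraph[OF sym_digraph_proper_power_graph _ _ assms(7) y(1)])
  then have "\<exists>t::nat. x = y [^]\<^bsub>G\<^esub> t"
  proof (induction rule: P.reachable_induct)
    case base
    show ?case
      using assms(3) by (intro exI[of _ 1]) simp
  next
    case (step v w)
    then show ?case
      using power_of_adjacent[OF assms(1,2) xp] by blast
  qed
  then obtain t :: nat where t: "x = y [^]\<^bsub>G\<^esub> t"
    by blast
  have "t > 0"
    using t assms(4) by (cases t) auto
  moreover have "y \<in> carrier G - {\<one>\<^bsub>G\<^esub>}"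
    using P.reachable_in_verts(2)[OF reach]
    by (simp add: proper_power_graph_def power_graph_def pre_digraph.del_vert_def)
  ultimately show "x \<rightarrow>\<^bsub>proper_power_graph G\<^esub> y"
    using assms(3,4) y(2) t by (auto simp: adjacent_proper_power_graph_iff)
qed

end
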